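(* Let $\mathcal{M}=\{p_\theta:\theta\in\Theta\}$ be a regular statistical model with Fisher-Rao distance $\rho$, let $\theta_0\neq\theta_1$ in $\Theta$, let $\bar\gamma:[0,1]\to\Theta$ be a Fisher-Rao pregeodesic from $\theta_0$ to $\theta_1$ tracing a length-minimizing geodesic, and let $\rho_L,\rho_U:\Theta\times\Theta\to[0,\infty)$ be lower and upper bounds, $\rho_L(\theta,\theta')\leq\rho(\theta,\theta')\leq\rho_U(\theta,\theta')$, that are tight at infinitesimal scale. Let $\epsilon>0$. Consider the recursive procedure $\mathrm{ApproxFisherRao}(\theta_0,\theta_1,\epsilon)$: if $\rho_U(\theta_0,\theta_1)>(1+\epsilon)\,\rho_L(\theta_0,\theta_1)$, cut the pregeodesic at $m=\bar\gamma(\tfrac12)$ and return $\mathrm{ApproxFisherRao}(\theta_0,m,\epsilon)+\mathrm{ApproxFisherRao}(m,\theta_1,\epsilon)$, where the recursive calls use the restrictions of $\bar\gamma$ to $[0,\tfrac12]$ and $[\tfrac12,1]$ (affinely reparameterized to $[0,1]$); otherwise return $\rho_U(\theta_0,\theta_1)$. Then the procedure terminates and its output $\tilde\rho_\epsilon(\theta_0,\theta_1)$ satisfies $$\rho(\theta_0,\theta_1)\leq\tilde\rho_\epsilon(\theta_0,\theta_1)\leq(1+\epsilon)\,\rho(\theta_0,\theta_1).$$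
   Context: A regular statistical model is a family of probability densities $p_\theta$ indexed by $\theta$ in a connected open set $\Theta\subset\mathbb{R}^m$, whose Fisher information matrix $I(\theta)$ is well defined, positive-definite and smooth. The Fisher-Rao distance $\rho$ is the Riemannian distance of the metric $I(\theta)$ on $\Theta$. A pregeodesic is a curve $\bar\gamma=\gamma\circ u$ where $\gamma:[0,1]\to\Theta$ is a constant-speed geodesic and $u:[0,1]\to[0,1]$ is an (increasing) diffeomorphism. The bounds $\rho_L,\rho_U$ are called tight at infinitesimal scale if for every $\eta>0$ every point of $\Theta$ has a neighborhood in which all pairs of distinct points $\theta,\theta'$ satisfy $\rho_U(\theta,\theta')\leq(1+\eta)\,\rho_L(\theta,\theta')$. *)

theory Defs
  imports "HOL-Probability.Probability"
begin

definition partial_deriv :: "'m::finite \<Rightarrow> (real ^ 'm \<Rightarrow> real) \<Rightarrow> real ^ 'm \<Rightarrow> real" where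
  "partial_deriv i f x = deriv (\<lambda>h. f (x + h *\<^sub>R axis i 1)) 0"

text \<open>Meant for open sets \<open>S\<close>.\<close>

primrec Ck_on ::
  "nat \<Rightarrow> ('a::real_normed_vector \<Rightarrow> 'b::real_normed_vector) \<Rightarrow> 'a set \<Rightarrow> bool" where
  "Ck_on 0 f S \<longleftrightarrow> continuous_on S f"
| "Ck_on (Suc k) f S \<longleftrightarrow>
     (\<forall>x\<in>S. f differentiable (at x)) \<and> (\<forall>v. Ck_on k (\<lambda>x. frechet_derivative f (at x) v) S)"

definition smooth_on ::
  "('a::real_normed_vector \<Rightarrow> 'b::real_normed_vector) \<Rightarrow> 'a set \<Rightarrow> bool" where
  "smooth_on f S \<longleftrightarrow> (\<forall>k. Ck_on k f S)"

text \<open>Derivatives of all orders on \<open>[0,1]\<close>, one-sided at the end points; \<open>D n\<close> is the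
  \<open>n\<close>-th derivative.\<close>

definition smooth_on_unit_interval :: "(real \<Rightarrow> real) \<Rightarrow> bool" where
  "smooth_on_unit_interval f \<longleftrightarrow>
     (\<exists>D :: nat \<Rightarrow> real \<Rightarrow> real. D 0 = f \<and>
        (\<forall>n. \<forall>t\<in>{0..1}. (D n has_real_derivative D (Suc n) t) (at t within {0..1})))"

definition increasing_diffeo :: "(real \<Rightarrow> real) \<Rightarrow> bool" where
  "increasing_diffeo u \<longleftrightarrow>
     bij_betw u {0..1} {0..1} \<and> strict_mono_on {0..1} u \<and>
     smooth_on_unit_interval u \<and> smooth_on_unit_interval (inv_into {0..1} u)"

text \<open>Densities \<open>p \<theta>\<close> are taken with respect to an arbitrary reference measure \<open>M\<close> on the
  sample space.\<close>

definition score :: "(real ^ 'm::finite \<Rightarrow> 'x \<Rightarrow> real) \<Rightarrow> 'm \<Rightarrow> real ^ 'm \<Rightarrow> 'x \<Rightarrow> real" where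
  "score p i \<theta> x = partial_deriv i (\<lambda>\<theta>'. ln (p \<theta>' x)) \<theta>"

text \<open>The factor \<open>p \<theta> x\<close> makes the value of the score irrelevant where the density vanishes.\<close>

definition fisher_information ::
  "'x measure \<Rightarrow> (real ^ 'm::finite \<Rightarrow> 'x \<Rightarrow> real) \<Rightarrow> real ^ 'm \<Rightarrow> real ^ 'm ^ 'm" where
  "fisher_information M p \<theta> =
     (\<chi> i j. integral\<^sup>L M (\<lambda>x. score p i \<theta> x * score p j \<theta> x * p \<theta> x))"

definition fisher_well_defined ::
  "'x measure \<Rightarrow> (real ^ 'm::finite \<Rightarrow> 'x \<Rightarrow> real) \<Rightarrow> real ^ 'm \<Rightarrow> bool" where
  "fisher_well_defined M p \<theta> \<longleftrightarrow>
     (AE x in M. p \<theta> x > 0 \<longrightarrow>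
        (\<forall>i. (\<lambda>h. p (\<theta> + h *\<^sub>R axis i 1) x) field_differentiable (at 0))) \<and>
     (\<forall>i j. integrable M (\<lambda>x. score p i \<theta> x * score p j \<theta> x * p \<theta> x))"

definition probability_density :: "'x measure \<Rightarrow> ('x \<Rightarrow> real) \<Rightarrow> bool" where
  "probability_density M f \<longleftrightarrow>
     f \<in> borel_measurable M \<and> (\<forall>x\<in>space M. f x \<ge> 0) \<and> prob_space (density M (\<lambda>x. ennreal (f x)))"

definition regular_statistical_model ::
  "'x measure \<Rightarrow> (real ^ 'm::finite) set \<Rightarrow> (real ^ 'm \<Rightarrow> 'x \<Rightarrow> real) \<Rightarrow> bool" where
  "regular_statistical_model M \<Theta> p \<longleftrightarrow>
     open \<Theta> \<and> connected \<Theta> \<and>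
     (\<forall>\<theta>\<in>\<Theta>. probability_density M (p \<theta>)) \<and>
     (\<forall>\<theta>\<in>\<Theta>. fisher_well_defined M p \<theta>) \<and>
     (\<forall>\<theta>\<in>\<Theta>. \<forall>v. v \<noteq> 0 \<longrightarrow> v \<bullet> (fisher_information M p \<theta> *v v) > 0) \<and>
     smooth_on (fisher_information M p) \<Theta>"

definition speed :: "(real ^ 'm::finite \<Rightarrow> real ^ 'm ^ 'm) \<Rightarrow> (real \<Rightarrow> real ^ 'm) \<Rightarrow> real \<Rightarrow> real" where
  "speed g c t =
     sqrt (vector_derivative c (at t) \<bullet> (g (c t) *v vector_derivative c (at t)))"

definition curve_length :: "(real ^ 'm::finite \<Rightarrow> real ^ 'm ^ 'm) \<Rightarrow> (real \<Rightarrow> real ^ 'm) \<Rightarrow> real" where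
  "curve_length g c = integral {0..1} (speed g c)"

text \<open>Piecewise \<open>C\<^sup>1\<close> curves of finite length. \<^const>\<open>valid_path\<close> does not bound the velocity near
  the finitely many exceptional parameters, so integrability of the speed is not automatic, and
  without it \<^const>\<open>integral\<close> would assign length 0 to a curve of infinite length.\<close>

definition admissible_curve ::
  "(real ^ 'm::finite \<Rightarrow> real ^ 'm ^ 'm) \<Rightarrow> (real ^ 'm) set \<Rightarrow> (real \<Rightarrow> real ^ 'm) \<Rightarrow> bool" where
  "admissible_curve g \<Theta> c \<longleftrightarrow>
     valid_path c \<and> path_image c \<subseteq> \<Theta> \<and> speed g c integrable_on {0..1}"

definition riemannian_distance ::
  "(real ^ 'm::finite \<Rightarrow> real ^ 'm ^ 'm) \<Rightarrow> (real ^ 'm) set \<Rightarrow> real ^ 'm \<Rightarrow> real ^ 'm \<Rightarrow> real" where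
  "riemannian_distance g \<Theta> x y =
     Inf {curve_length g c | c. admissible_curve g \<Theta> c \<and> pathstart c = x \<and> pathfinish c = y}"

definition christoffel ::
  "(real ^ 'm::finite \<Rightarrow> real ^ 'm ^ 'm) \<Rightarrow> real ^ 'm \<Rightarrow> 'm \<Rightarrow> 'm \<Rightarrow> 'm \<Rightarrow> real" where
  "christoffel g \<theta> k i j =
     (\<Sum>l\<in>UNIV. matrix_inv (g \<theta>) $ k $ l *
        (partial_deriv i (\<lambda>\<theta>'. g \<theta>' $ j $ l) \<theta> +
         partial_deriv j (\<lambda>\<theta>'. g \<theta>' $ i $ l) \<theta> -
         partial_deriv l (\<lambda>\<theta>'. g \<theta>' $ i $ j) \<theta>)) / 2"

text \<open>Solutions of the geodesic equation on \<open>[0,1]\<close>; these automatically have constant speed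
  (possibly 0).\<close>

definition constant_speed_geodesic ::
  "(real ^ 'm::finite \<Rightarrow> real ^ 'm ^ 'm) \<Rightarrow> (real ^ 'm) set \<Rightarrow> (real \<Rightarrow> real ^ 'm) \<Rightarrow> bool" where
  "constant_speed_geodesic g \<Theta> \<gamma> \<longleftrightarrow>
     \<gamma> ` {0..1} \<subseteq> \<Theta> \<and>
     (\<exists>v. \<forall>t\<in>{0..1}.
        (\<gamma> has_vector_derivative v t) (at t within {0..1}) \<and>
        (v has_vector_derivative
           (\<chi> k. - (\<Sum>i\<in>UNIV. \<Sum>j\<in>UNIV. christoffel g (\<gamma> t) k i j * v t $ i * v t $ j)))
          (at t within {0..1}))"

definition length_minimizing ::
  "(real ^ 'm::finite \<Rightarrow> real ^ 'm ^ 'm) \<Rightarrow> (real ^ 'm) set \<Rightarrow> (real \<Rightarrow> real ^ 'm) \<Rightarrow> bool" where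
  "length_minimizing g \<Theta> \<gamma> \<longleftrightarrow> curve_length g \<gamma> = riemannian_distance g \<Theta> (\<gamma> 0) (\<gamma> 1)"

definition pregeodesic_tracing ::
  "(real ^ 'm::finite \<Rightarrow> real ^ 'm ^ 'm) \<Rightarrow> (real ^ 'm) set \<Rightarrow>
     (real \<Rightarrow> real ^ 'm) \<Rightarrow> (real \<Rightarrow> real ^ 'm) \<Rightarrow> bool" where
  "pregeodesic_tracing g \<Theta> \<gamma> c \<longleftrightarrow>
     constant_speed_geodesic g \<Theta> \<gamma> \<and>
     (\<exists>u. increasing_diffeo u \<and> (\<forall>t\<in>{0..1}. c t = \<gamma> (u t)))"

abbreviation fisher_rao_distance ::
  "'x measure \<Rightarrow> (real ^ 'm::finite) set \<Rightarrow> (real ^ 'm \<Rightarrow> 'x \<Rightarrow> real) \<Rightarrow>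
     real ^ 'm \<Rightarrow> real ^ 'm \<Rightarrow> real" where
  "fisher_rao_distance M \<Theta> p \<equiv> riemannian_distance (fisher_information M p) \<Theta>"

definition infinitesimally_tight ::
  "'a::topological_space set \<Rightarrow> ('a \<Rightarrow> 'a \<Rightarrow> real) \<Rightarrow> ('a \<Rightarrow> 'a \<Rightarrow> real) \<Rightarrow> bool" where
  "infinitesimally_tight \<Theta> \<rho>L \<rho>U \<longleftrightarrow>
     (\<forall>\<eta>>0. \<forall>x\<in>\<Theta>. \<exists>N. open N \<and> x \<in> N \<and> N \<subseteq> \<Theta> \<and>
        (\<forall>\<theta>\<in>N. \<forall>\<theta>'\<in>N. \<theta> \<noteq> \<theta>' \<longrightarrow> \<rho>U \<theta> \<theta>' \<le> (1 + \<eta>) * \<rho>L \<theta> \<theta>'))"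

text \<open>The end points of the current call are \<open>c 0\<close> and \<open>c 1\<close>. No termination proof is given: the
  domain predicate \<open>approx_fisher_rao_dom\<close> holds of exactly the arguments on which the recursion
  terminates.\<close>

function (domintros) approx_fisher_rao ::
  "('a \<Rightarrow> 'a \<Rightarrow> real) \<Rightarrow> ('a \<Rightarrow> 'a \<Rightarrow> real) \<Rightarrow> real \<Rightarrow> (real \<Rightarrow> 'a) \<Rightarrow> real" where
  "approx_fisher_rao \<rho>L \<rho>U \<epsilon> c =
     (if \<rho>U (c 0) (c 1) > (1 + \<epsilon>) * \<rho>L (c 0) (c 1)
      then approx_fisher_rao \<rho>L \<rho>U \<epsilon> (\<lambda>t. c (t / 2)) +
           approx_fisher_rao \<rho>L \<rho>U \<epsilon> (\<lambda>t. c ((1 + t) / 2))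
      else \<rho>U (c 0) (c 1))"
  by pat_completeness auto

end

theory Submission
  imports Defs
begin

text \<open>A solution of the geodesic equation has constant speed, so a length-minimizing geodesic
  \<open>\<gamma>\<close> of speed \<open>k\<close> satisfies \<open>\<rho>(\<gamma> a, \<gamma> b) = k (b - a)\<close>: a shorter detour between \<open>\<gamma> a\<close> and
  \<open>\<gamma> b\<close> could be spliced into \<open>\<gamma>\<close>. Since \<open>\<theta>0 \<noteq> \<theta>1\<close> forces \<open>k > 0\<close>, the pregeodesic is injective
  and \<open>\<rho>\<close> is additive along it. A Lebesgue number of the cover of its compact image by
  neighborhoods on which \<open>\<rho>U \<le> (1 + \<epsilon>) \<rho>L\<close> bounds the depth of the recursion; injectivity is what
  makes this inequality, known only for distinct points, available at every cut. Additivity of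
  \<open>\<rho>\<close> propagates the two bounds from the leaves to the root.\<close>

section \<open>The recursion along an injective curve, for an abstract additive
  \<open>d\<close>\<close>

lemma approx_fisher_rao_along_curve:
  fixes c :: "real \<Rightarrow> 'a::metric_space" and d :: "'a \<Rightarrow> 'a \<Rightarrow> real"
  assumes cont: "continuous_on {0..1} c"
    and inj: "inj_on c {0..1}"
    and img: "c ` {0..1} \<subseteq> \<Theta>"
    and additive: "\<And>r s t. 0 \<le> r \<Longrightarrow> r \<le> s \<Longrightarrow> s \<le> t \<Longrightarrow> t \<le> 1 \<Longrightarrow>
      d (c r) (c t) = d (c r) (c s) + d (c s) (c t)"
    and bounds: "\<And>x y. x \<in> \<Theta> \<Longrightarrow> y \<in> \<Theta> \<Longrightarrow> \<rho>L x y \<le> d x y \<and> d x y \<le> \<rho>U x y"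
    and tight: "infinitesimally_tight \<Theta> \<rho>L \<rho>U"
    and eps: "\<epsilon> > 0"
  shows "approx_fisher_rao_dom (\<rho>L, \<rho>U, \<epsilon>, c) \<and>
         d (c 0) (c 1) \<le> approx_fisher_rao \<rho>L \<rho>U \<epsilon> c \<and>
         approx_fisher_rao \<rho>L \<rho>U \<epsilon> c \<le> (1 + \<epsilon>) * d (c 0) (c 1)"
proof -
  \<comment> \<open>Tightness is instantiated at \<open>\<eta> = \<epsilon>\<close>, so that inside
    such a set the tightness inequality is exactly the stopping test.\<close>
  define tight_nbhd where "tight_nbhd N \<longleftrightarrow> open N \<and>
    (\<forall>x\<in>N. \<forall>y\<in>N. x \<noteq> y \<longrightarrow> \<rho>U x y \<le> (1 + \<epsilon>) * \<rho>L x y)" for N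
  have cover: "c ` {0..1} \<subseteq> \<Union>{N. tight_nbhd N}"
  proof
    fix x assume "x \<in> c ` {0..1}"
    with img have "x \<in> \<Theta>" by blast
    with tight eps obtain N where "open N" "x \<in> N"
        "\<forall>\<theta>\<in>N. \<forall>\<theta>'\<in>N. \<theta> \<noteq> \<theta>' \<longrightarrow> \<rho>U \<theta> \<theta>' \<le> (1 + \<epsilon>) * \<rho>L \<theta> \<theta>'"
      unfolding infinitesimally_tight_def by meson
    then show "x \<in> \<Union>{N. tight_nbhd N}"
      unfolding tight_nbhd_def by blast
  qed
  have "compact (c ` {0..1})"
    using cont by (intro compact_continuous_image) auto
  then obtain e where e: "e > 0"
      "\<And>x. x \<in> c ` {0..1} \<Longrightarrow> \<exists>N\<in>{N. tight_nbhd N}. ball x e \<subseteq> N"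
    by (rule Heine_Borel_lemma [OF _ cover]) (auto simp: tight_nbhd_def)
  \<comment> \<open>The Lebesgue number \<open>e\<close> measures distances in the image; uniform
    continuity converts it into a threshold \<open>\<delta>\<close> for the length of parameter
    intervals, which is what the recursion halves.\<close>
  have "uniformly_continuous_on {0..1} c"
    using cont by (intro compact_uniformly_continuous) auto
  with e(1) obtain \<delta> where \<delta>: "\<delta> > 0"
      "\<And>s t. s \<in> {0..1} \<Longrightarrow> t \<in> {0..1} \<Longrightarrow> dist t s < \<delta> \<Longrightarrow> dist (c t) (c s) < e"
    unfolding uniformly_continuous_on_def by meson
  have stop: "\<rho>U (c a) (c b) \<le> (1 + \<epsilon>) * \<rho>L (c a) (c b)"
    if ab: "0 \<le> a" "a < b" "b \<le> 1" "b - a < \<delta>" for a b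
  proof -
    obtain N where N: "tight_nbhd N" "ball (c a) e \<subseteq> N"
      using e(2)[of "c a"] ab by auto
    have "dist (c b) (c a) < e"
      using ab by (intro \<delta>(2)) (auto simp: dist_real_def)
    then have "c a \<in> N" "c b \<in> N"
      using N(2) e(1) by (auto simp: dist_commute)
    moreover have "c a \<noteq> c b"
      using inj_onD[OF inj, of a b] ab by auto
    ultimately show ?thesis
      using N(1) unfolding tight_nbhd_def by blast
  qed
  have sandwich: "\<rho>L (c a) (c b) \<le> d (c a) (c b)" "d (c a) (c b) \<le> \<rho>U (c a) (c b)"
      "(1 + \<epsilon>) * \<rho>L (c a) (c b) \<le> (1 + \<epsilon>) * d (c a) (c b)"
    if "0 \<le> a" "a < b" "b \<le> 1" for a b
  proof -
    have "c a \<in> \<Theta>" "c b \<in> \<Theta>"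
      using img that by auto
    then show "\<rho>L (c a) (c b) \<le> d (c a) (c b)" "d (c a) (c b) \<le> \<rho>U (c a) (c b)"
      using bounds by blast+
    then show "(1 + \<epsilon>) * \<rho>L (c a) (c b) \<le> (1 + \<epsilon>) * d (c a) (c b)"
      using eps by (intro mult_left_mono) auto
  qed
  define sub where "sub a b = (\<lambda>t. c (a + (b - a) * t))" for a b
  have sub_ends [simp]: "sub a b 0 = c a" "sub a b 1 = c b" for a b
    by (simp_all add: sub_def)
  \<comment> \<open>These are equalities of functions on all of \<open>real\<close>. The domain
    predicate and \<open>psimps\<close> see the recursive calls as literal terms, so agreement on
    \<open>{0..1}\<close> would not suffice to identify them with calls of the form
    \<open>sub\<close>.\<close>
  have halves: "(\<lambda>t. sub a b (t / 2)) = sub a ((a + b) / 2)"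
      "(\<lambda>t. sub a b ((1 + t) / 2)) = sub ((a + b) / 2) b" for a b
    unfolding sub_def by (auto intro!: ext arg_cong[where f = c] simp: field_simps)
  \<comment> \<open>The exponent \<open>n\<close> bounds the remaining depth: halving an interval
    lowers it by one, and at \<open>0\<close> the interval is shorter than \<open>\<delta>\<close>.
    Termination and both estimates are carried together, since the recursion equation is available
    only on the domain.\<close>
  have main: "approx_fisher_rao_dom (\<rho>L, \<rho>U, \<epsilon>, sub a b) \<and>
      d (c a) (c b) \<le> approx_fisher_rao \<rho>L \<rho>U \<epsilon> (sub a b) \<and>
      approx_fisher_rao \<rho>L \<rho>U \<epsilon> (sub a b) \<le> (1 + \<epsilon>) * d (c a) (c b)"
    if "0 \<le> a" "a < b" "b \<le> 1" "b - a < 2 ^ n * \<delta>" for a b n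
    using that
  proof (induction n arbitrary: a b)
    case base: 0
    have *: "\<not> \<rho>U (c a) (c b) > (1 + \<epsilon>) * \<rho>L (c a) (c b)"
      using stop[of a b] base by simp
    then have dom: "approx_fisher_rao_dom (\<rho>L, \<rho>U, \<epsilon>, sub a b)"
      by - (rule approx_fisher_rao.domintros, auto)
    \<comment> \<open>A leaf returns \<open>\<rho>U\<close>, and the chain \<open>d \<le> \<rho>U
      \<le> (1 + \<epsilon>) * \<rho>L \<le> (1 + \<epsilon>) * d\<close> gives both bounds.\<close>
    show ?case
      using dom * sandwich[of a b] base by (simp add: approx_fisher_rao.psimps[OF dom])
  next
    case (Suc n)
    define m where "m = (a + b) / 2"
    have m: "a < m" "m < b" "m - a < 2 ^ n * \<delta>" "b - m < 2 ^ n * \<delta>"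
      using Suc.prems by (auto simp: m_def field_simps)
    note L = Suc.IH[of a m] and R = Suc.IH[of m b]
    \<comment> \<open>The two halves are in the domain by induction whether or not the test asks for
      a cut, so no case split is needed yet.\<close>
    have dom: "approx_fisher_rao_dom (\<rho>L, \<rho>U, \<epsilon>, sub a b)"
    proof (rule approx_fisher_rao.domintros)
      show "approx_fisher_rao_dom (\<rho>L, \<rho>U, \<epsilon>, \<lambda>t. sub a b (t / 2))"
        using L m Suc.prems by (simp add: halves m_def)
      show "approx_fisher_rao_dom (\<rho>L, \<rho>U, \<epsilon>, \<lambda>t. sub a b ((1 + t) / 2))"
        using R m Suc.prems by (simp add: halves m_def)
    qed
    show ?case
    \<comment> \<open>At a cut the bounds of the halves are added, and additivity of
      \<open>d\<close> recombines them. Without a cut this node is a leaf, even if its interval is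
      still longer than \<open>\<delta>\<close>.\<close>
    proof (cases "\<rho>U (c a) (c b) > (1 + \<epsilon>) * \<rho>L (c a) (c b)")
      case True
      have "d (c a) (c b) = d (c a) (c m) + d (c m) (c b)"
        using m Suc.prems by (intro additive) auto
      moreover have "approx_fisher_rao \<rho>L \<rho>U \<epsilon> (sub a b) =
          approx_fisher_rao \<rho>L \<rho>U \<epsilon> (sub a m) + approx_fisher_rao \<rho>L \<rho>U \<epsilon> (sub m b)"
        using True by (simp add: approx_fisher_rao.psimps[OF dom] halves m_def)
      ultimately show ?thesis
        using dom L R m Suc.prems by (simp add: distrib_left)
    next
      case False
      then show ?thesis
        using dom sandwich[of a b] Suc.prems by (simp add: approx_fisher_rao.psimps[OF dom])
    qed
  qed
  obtain n where "1 / \<delta> < 2 ^ n"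
    using real_arch_pow[of 2 "1 / \<delta>"] by auto
  then have "1 - 0 < 2 ^ n * \<delta>"
    using \<delta>(1) by (simp add: field_simps)
  moreover have "sub 0 1 = c"
    by (simp add: sub_def)
  ultimately show ?thesis
    using main[of 0 1 n] by simp
qed

section \<open>Lengths of joined curves and of constant-speed curves\<close>

text \<open>Each piece is run through in half the time at twice the speed, so its length is
  preserved. The junction and the finitely many points of non-differentiability are negligible for
  the integral.\<close>

lemma
  fixes c1 c2 :: "real \<Rightarrow> real ^ 'm::finite"
  assumes c1: "admissible_curve g \<Theta> c1" and c2: "admissible_curve g \<Theta> c2"
    and meet: "pathfinish c1 = pathstart c2"
  shows admissible_curve_join: "admissible_curve g \<Theta> (c1 +++ c2)"
    and curve_length_join:
      "curve_length g (c1 +++ c2) = curve_length g c1 + curve_length g c2"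
proof -
  obtain s1 s2
    where s1: "finite s1" "\<forall>x\<in>{0..1} - s1. c1 differentiable at x"
      and s2: "finite s2" "\<forall>x\<in>{0..1} - s2. c2 differentiable at x"
    using c1 c2
    by (auto simp: admissible_curve_def valid_path_def piecewise_C1_differentiable_on_def
        C1_differentiable_on_eq)
  have 1: "(speed g c1 has_integral curve_length g c1) {0..1}"
   and 2: "(speed g c2 has_integral curve_length g c2) {0..1}"
    using c1 c2 by (auto simp: admissible_curve_def curve_length_def)
  \<comment> \<open>Affine substitution, multiplied by \<open>2\<close> to cancel the Jacobian; the
    integrands are the expected speeds of the two halves of the join.\<close>
  have i1: "((\<lambda>x. 2 * speed g c1 (2 * x)) has_integral curve_length g c1) {0..1/2}"
   and i2: "((\<lambda>x. 2 * speed g c2 (2 * x - 1)) has_integral curve_length g c2) {1/2..1}"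
    using has_integral_affinity01 [OF 1, where m= 2 and c=0, THEN has_integral_cmul [where c=2]]
          has_integral_affinity01 [OF 2, where m= 2 and c="-1", THEN has_integral_cmul [where c=2]]
    by (simp_all only: image_affinity_atLeastAtMost_div_diff, simp_all)
  \<comment> \<open>The quadratic form under the root is homogeneous of degree two, so the speed
    scales like the velocity.\<close>
  have scale: "speed g (c1 +++ c2) x = 2 * speed g c t"
    if "(c1 +++ c2) x = c t" "vector_derivative (c1 +++ c2) (at x) = 2 *\<^sub>R vector_derivative c (at t)"
    for c x t
    using that by (simp add: speed_def matrix_vector_mult_scaleR real_sqrt_mult)
  have g1: "speed g (c1 +++ c2) z = 2 * speed g c1 (2 * z)"
      if "0 \<le> z" "z*2 < 1" "z*2 \<notin> s1" for z
  proof (rule scale)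
    show "(c1 +++ c2) z = c1 (2 * z)"
      using that by (simp add: joinpaths_def)
    show "vector_derivative (c1 +++ c2) (at z) = 2 *\<^sub>R vector_derivative c1 (at (2 * z))"
    proof (rule vector_derivative_at [OF has_vector_derivative_transform_within])
      \<comment> \<open>Within this radius of \<open>z\<close> the midpoint is not crossed, so the
        join coincides with its first piece there.\<close>
      show "0 < \<bar>z - 1/2\<bar>"
        using that by auto
      have "((*) 2 has_vector_derivative 2) (at z)"
        by (simp add: has_vector_derivative_def has_derivative_def bounded_linear_mult_left)
      moreover have "(c1 has_vector_derivative vector_derivative c1 (at (2 * z))) (at (2 * z))"
        using s1 that by (auto simp: algebra_simps vector_derivative_works)
      ultimately
      show "((\<lambda>x. c1 (2 * x)) has_vector_derivative 2 *\<^sub>R vector_derivative c1 (at (2 * z))) (at z)"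
        by (intro vector_diff_chain_at [simplified o_def])
    qed (use that in \<open>simp_all add: joinpaths_def dist_real_def abs_if split: if_split_asm\<close>)
  qed
  have g2: "speed g (c1 +++ c2) z = 2 * speed g c2 (2 * z - 1)"
      if "1 < z*2" "z \<le> 1" "z*2 - 1 \<notin> s2" for z
  proof (rule scale)
    show "(c1 +++ c2) z = c2 (2 * z - 1)"
      using that by (simp add: joinpaths_def)
    show "vector_derivative (c1 +++ c2) (at z) = 2 *\<^sub>R vector_derivative c2 (at (2 * z - 1))"
    proof (rule vector_derivative_at [OF has_vector_derivative_transform_within])
      show "0 < \<bar>z - 1/2\<bar>"
        using that by auto
      have "((\<lambda>x. 2 * x - 1) has_vector_derivative 2) (at z)"
        by (simp add: has_vector_derivative_def has_derivative_def bounded_linear_mult_left)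
      moreover have "(c2 has_vector_derivative vector_derivative c2 (at (2 * z - 1))) (at (2 * z - 1))"
        using s2 that by (auto simp: algebra_simps vector_derivative_works)
      ultimately
      show "((\<lambda>x. c2 (2 * x - 1)) has_vector_derivative 2 *\<^sub>R vector_derivative c2 (at (2 * z - 1))) (at z)"
        by (intro vector_diff_chain_at [simplified o_def])
    qed (use that in \<open>simp_all add: joinpaths_def dist_real_def abs_if split: if_split_asm\<close>)
  qed
  have "(speed g (c1 +++ c2) has_integral curve_length g c1) {0..1/2}"
  proof (rule has_integral_spike_finite [OF _ _ i1])
    show "finite (insert (1/2) ((*) 2 -` s1))"
      using s1 by (force intro: finite_vimageI [where h = "(*)2"] inj_onI)
  qed (auto simp: g1 mult.commute)
  moreover have "(speed g (c1 +++ c2) has_integral curve_length g c2) {1/2..1}"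
  proof (rule has_integral_spike_finite [OF _ _ i2])
    show "finite (insert (1/2) ((\<lambda>x. 2 * x - 1) -` s2))"
      using s2 by (force intro: finite_vimageI [where h = "\<lambda>x. 2*x-1"] inj_onI)
  qed (auto simp: g2 mult.commute)
  ultimately have *: "(speed g (c1 +++ c2) has_integral curve_length g c1 + curve_length g c2) {0..1}"
    by (simp add: has_integral_combine [where c = "1/2"])
  then show "curve_length g (c1 +++ c2) = curve_length g c1 + curve_length g c2"
    by (simp add: curve_length_def integral_unique)
  show "admissible_curve g \<Theta> (c1 +++ c2)"
    using * c1 c2 meet
    by (auto simp: admissible_curve_def path_image_join intro: valid_path_join)
qed

text \<open>One-sided derivatives at \<open>0\<close> and \<open>1\<close> do not determine the
  two-sided ones in \<open>speed\<close>, because \<open>c\<close> is arbitrary outside the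
  interval. Both end points are therefore treated as exceptional, in the integral and in the
  piecewise \<open>C1\<close> condition.\<close>

lemma
  fixes c :: "real \<Rightarrow> real ^ 'm::finite"
  assumes der: "\<And>t. t \<in> {0..1} \<Longrightarrow> (c has_vector_derivative w t) (at t within {0..1})"
    and cont: "continuous_on {0..1} w"
    and img: "c ` {0..1} \<subseteq> \<Theta>"
    and speed: "\<And>t. t \<in> {0..1} \<Longrightarrow> sqrt (w t \<bullet> (g (c t) *v w t)) = k"
  shows admissible_curve_constant_speed: "admissible_curve g \<Theta> c"
    and curve_length_constant_speed: "curve_length g c = k"
proof -
  have at: "(c has_vector_derivative w t) (at t)" if "t \<in> {0<..<1}" for t
    using der[of t] at_within_interior[of t "{0..1}"] that by auto
  have "((\<lambda>t. k) has_integral k) {0..1::real}"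
    using has_integral_const_real[of k 0 1] by simp
  then have int: "(speed g c has_integral k) {0..1}"
  proof (rule has_integral_spike_finite[of "{0, 1}", rotated 2])
    fix x :: real assume "x \<in> {0..1} - {0, 1}"
    then show "speed g c x = k"
      using speed[of x] vector_derivative_at[OF at[of x]] by (simp add: speed_def)
  qed simp
  then show "curve_length g c = k"
    by (simp add: curve_length_def integral_unique)
  have "continuous_on {0..1} c"
    using der unfolding continuous_on_eq_continuous_within by (blast intro: has_vector_derivative_continuous)
  moreover have "c C1_differentiable_on ({0..1} - {0, 1})"
    unfolding C1_differentiable_on_def
    using at by (intro exI[of _ w]) (auto intro: continuous_on_subset[OF cont])
  ultimately have "valid_path c"
    unfolding valid_path_def piecewise_C1_differentiable_on_def
    by (intro conjI exI[of _ "{0, 1}"]) auto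
  then show "admissible_curve g \<Theta> c"
    using int img by (auto simp: admissible_curve_def path_image_def)
qed

section \<open>Geodesics have constant speed\<close>

text \<open>Links the coordinate derivatives in the Christoffel symbols, defined through
  \<open>deriv\<close> along a line, to the Frechet derivative that the chain rule along a curve
  produces.\<close>

lemma partial_deriv_component:
  fixes g :: "real ^ 'm::finite \<Rightarrow> real ^ 'm ^ 'm"
  assumes "(g has_derivative D) (at x)"
  shows "partial_deriv k (\<lambda>\<theta>. g \<theta> $ i $ j) x = D (axis k 1) $ i $ j"
proof -
  have "((\<lambda>h::real. x + h *\<^sub>R axis k 1) has_derivative (\<lambda>h. h *\<^sub>R axis k 1)) (at 0)"
    by (auto intro!: derivative_eq_intros)
  moreover have "((\<lambda>\<theta>. g \<theta> $ i $ j) has_derivative (\<lambda>v. D v $ i $ j)) (at (x + 0 *\<^sub>R axis k 1))"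
    using assms
    by (auto intro!: bounded_linear.has_derivative[OF bounded_linear_vec_nth])
  ultimately have "((\<lambda>h. g (x + h *\<^sub>R axis k 1) $ i $ j) has_derivative
      (\<lambda>h. D (h *\<^sub>R axis k 1) $ i $ j)) (at 0)"
    by (rule has_derivative_compose)
  moreover have "(\<lambda>h. D (h *\<^sub>R axis k 1) $ i $ j) = (\<lambda>h. (D (axis k 1) $ i $ j) * h)"
    using has_derivative_bounded_linear[OF assms]
    by (auto simp: linear_simps)
  ultimately have "((\<lambda>h. g (x + h *\<^sub>R axis k 1) $ i $ j) has_real_derivative D (axis k 1) $ i $ j) (at 0)"
    by (simp add: has_field_derivative_def)
  then show ?thesis
    by (simp add: partial_deriv_def DERIV_imp_deriv)
qed

lemma has_derivative_component_expansion:
  fixes g :: "real ^ 'm::finite \<Rightarrow> real ^ 'm ^ 'm"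
  assumes "(g has_derivative D) (at x)"
  shows "D v $ i $ j = (\<Sum>k\<in>UNIV. partial_deriv k (\<lambda>\<theta>. g \<theta> $ i $ j) x * v $ k)"
proof -
  have "linear D"
    using has_derivative_bounded_linear[OF assms] by (rule bounded_linear.linear)
  have "D v = D (\<Sum>k\<in>UNIV. v $ k *\<^sub>R axis k 1)"
    by (simp add: basis_expansion flip: scalar_mult_eq_scaleR)
  also have "\<dots> = (\<Sum>k\<in>UNIV. v $ k *\<^sub>R D (axis k 1))"
    using \<open>linear D\<close> by (simp add: linear_sum linear_cmul)
  finally show ?thesis
    by (simp add: partial_deriv_component[OF assms] mult.commute)
qed

text \<open>A kernel vector would make the quadratic form vanish, so the kernel is trivial and the
  square matrix is invertible.\<close>

lemma positive_definite_matrix_inv: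
  fixes A :: "real ^ 'm::finite ^ 'm"
  assumes "\<And>v. v \<noteq> 0 \<Longrightarrow> v \<bullet> (A *v v) > 0"
  shows "A ** matrix_inv A = mat 1"
proof -
  have "invertible A"
    unfolding invertible_left_inverse matrix_left_invertible_ker
    using assms by force
  then show ?thesis
    unfolding invertible_def matrix_inv_def by (metis (mono_tags, lifting) someI_ex)
qed

text \<open>The pairing of velocity with acceleration that occurs in the derivative of the energy:
  it yields, with opposite sign, the term coming from the derivative of the metric along the
  curve.\<close>

lemma christoffel_contraction:
  fixes g :: "real ^ 'm::finite \<Rightarrow> real ^ 'm ^ 'm" and v :: "real ^ 'm"
  assumes inv: "g x ** matrix_inv (g x) = mat 1"
  shows "2 * (v \<bullet> (g x *v (\<chi> k. - (\<Sum>i\<in>UNIV. \<Sum>j\<in>UNIV. christoffel g x k i j * v $ i * v $ j)))) =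
    - (\<Sum>i\<in>UNIV. \<Sum>j\<in>UNIV. \<Sum>k\<in>UNIV. partial_deriv k (\<lambda>\<theta>. g \<theta> $ i $ j) x * v $ i * v $ j * v $ k)"
proof -
  define P where "P k i j = partial_deriv k (\<lambda>\<theta>. g \<theta> $ i $ j) x" for k i j
  \<comment> \<open>\<open>- w\<close> collects the Christoffel symbols of the first kind: the inverse metric cancels.\<close>
  define w :: "real ^ 'm" where
    "w = (\<chi> l. - (\<Sum>i\<in>UNIV. \<Sum>j\<in>UNIV. (P i j l + P j i l - P l i j) / 2 * v $ i * v $ j))"
  have "(\<chi> k. - (\<Sum>i\<in>UNIV. \<Sum>j\<in>UNIV. christoffel g x k i j * v $ i * v $ j)) = matrix_inv (g x) *v w"
  proof (subst vec_eq_iff, intro allI)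
    fix k
    let ?m = "\<lambda>l. matrix_inv (g x) $ k $ l"
    have "(matrix_inv (g x) *v w) $ k =
       - (\<Sum>l\<in>UNIV. \<Sum>i\<in>UNIV. \<Sum>j\<in>UNIV. ?m l * ((P i j l + P j i l - P l i j) / 2 * v $ i * v $ j))"
      by (simp add: matrix_vector_mult_def w_def sum_distrib_left sum_negf)
    also have "\<dots> = - (\<Sum>i\<in>UNIV. \<Sum>j\<in>UNIV. \<Sum>l\<in>UNIV. ?m l * ((P i j l + P j i l - P l i j) / 2 * v $ i * v $ j))"
      by (subst sum.swap, subst (2) sum.swap) (rule refl)
    also have "\<dots> = - (\<Sum>i\<in>UNIV. \<Sum>j\<in>UNIV. christoffel g x k i j * v $ i * v $ j)"
      unfolding christoffel_def P_def sum_divide_distrib sum_distrib_right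
      by (intro arg_cong[where f = uminus] sum.cong refl) (simp add: algebra_simps)
    finally show "(\<chi> k. - (\<Sum>i\<in>UNIV. \<Sum>j\<in>UNIV. christoffel g x k i j * v $ i * v $ j)) $ k =
        (matrix_inv (g x) *v w) $ k"
      by simp
  qed
  then have "g x *v (\<chi> k. - (\<Sum>i\<in>UNIV. \<Sum>j\<in>UNIV. christoffel g x k i j * v $ i * v $ j)) = w"
    by (simp add: matrix_vector_mul_assoc inv)
  moreover have "2 * (v \<bullet> w) = - (\<Sum>i\<in>UNIV. \<Sum>j\<in>UNIV. \<Sum>k\<in>UNIV. P k i j * v $ i * v $ j * v $ k)"
  proof -
    \<comment> \<open>The three terms of the bracket are \<open>T\<close> with permuted indices.
      Their full sums agree, so two with a plus and one with a minus leave a single sum.\<close>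
    define T where "T i j l = P i j l * v $ i * v $ j * v $ l" for i j l
    have "2 * (v \<bullet> w) = (\<Sum>l\<in>UNIV. \<Sum>i\<in>UNIV. \<Sum>j\<in>UNIV.
        2 * (v $ l * - ((P i j l + P j i l - P l i j) / 2 * v $ i * v $ j)))"
      by (simp only: inner_vec_def w_def vec_lambda_beta inner_real_def sum_negf[symmetric] sum_distrib_left)
    also have "\<dots> = - (\<Sum>l\<in>UNIV. \<Sum>i\<in>UNIV. \<Sum>j\<in>UNIV. T i j l + T j i l - T l i j)"
      unfolding sum_negf[symmetric] T_def by (intro sum.cong refl) (simp add: field_simps)
    also have "\<dots> = - ((\<Sum>l\<in>UNIV. \<Sum>i\<in>UNIV. \<Sum>j\<in>UNIV. T i j l) +
        (\<Sum>l\<in>UNIV. \<Sum>i\<in>UNIV. \<Sum>j\<in>UNIV. T j i l) - (\<Sum>l\<in>UNIV. \<Sum>i\<in>UNIV. \<Sum>j\<in>UNIV. T l i j))"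
      by (simp add: sum.distrib sum_subtractf)
    also have "(\<Sum>l\<in>UNIV. \<Sum>i\<in>UNIV. \<Sum>j\<in>UNIV. T j i l) = (\<Sum>l\<in>UNIV. \<Sum>i\<in>UNIV. \<Sum>j\<in>UNIV. T i j l)"
      by (subst (2) sum.swap) (rule refl)
    also have "(\<Sum>l\<in>UNIV. \<Sum>i\<in>UNIV. \<Sum>j\<in>UNIV. T i j l) = (\<Sum>i\<in>UNIV. \<Sum>j\<in>UNIV. \<Sum>l\<in>UNIV. T i j l)"
      by (subst sum.swap, subst (2) sum.swap) (rule refl)
    also have "(\<Sum>i\<in>UNIV. \<Sum>j\<in>UNIV. \<Sum>l\<in>UNIV. T i j l) = (\<Sum>i\<in>UNIV. \<Sum>j\<in>UNIV. \<Sum>k\<in>UNIV. T k i j)"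
      by (subst (2) sum.swap, subst sum.swap) (rule refl)
    finally show ?thesis
      by (simp add: T_def mult_ac)
  qed
  ultimately show ?thesis
    by (simp add: P_def)
qed

text \<open>The energy has derivative zero: the product rule gives one term from the metric and two
  from the acceleration, which cancel by \<open>christoffel_contraction\<close>.\<close>

lemma geodesic_speed_constant:
  fixes g :: "real ^ 'm::finite \<Rightarrow> real ^ 'm ^ 'm" and \<gamma> v :: "real \<Rightarrow> real ^ 'm"
  assumes diff: "\<And>x. x \<in> \<Theta> \<Longrightarrow> g differentiable (at x)"
    and sym: "\<And>x i j. x \<in> \<Theta> \<Longrightarrow> g x $ i $ j = g x $ j $ i"
    and pos: "\<And>x v. x \<in> \<Theta> \<Longrightarrow> v \<noteq> 0 \<Longrightarrow> v \<bullet> (g x *v v) > 0"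
    and img: "\<gamma> ` {0..1} \<subseteq> \<Theta>"
    and der: "\<And>t. t \<in> {0..1} \<Longrightarrow> (\<gamma> has_vector_derivative v t) (at t within {0..1})"
    and geo: "\<And>t. t \<in> {0..1} \<Longrightarrow> (v has_vector_derivative
           (\<chi> k. - (\<Sum>i\<in>UNIV. \<Sum>j\<in>UNIV. christoffel g (\<gamma> t) k i j * v t $ i * v t $ j)))
          (at t within {0..1})"
  obtains E where "\<And>t. t \<in> {0..1} \<Longrightarrow> v t \<bullet> (g (\<gamma> t) *v v t) = E"
proof -
  have "((\<lambda>t. v t \<bullet> (g (\<gamma> t) *v v t)) has_vector_derivative 0) (at t within {0..1})"
    if t: "t \<in> {0..1}" for t
  proof -
    define a where "a = (\<chi> k. - (\<Sum>i\<in>UNIV. \<Sum>j\<in>UNIV. christoffel g (\<gamma> t) k i j * v t $ i * v t $ j))"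
    have \<gamma>t: "\<gamma> t \<in> \<Theta>" using img t by auto
    obtain D where D: "(g has_derivative D) (at (\<gamma> t))"
      using diff[OF \<gamma>t] by (auto simp: differentiable_def)
    have "((\<lambda>t. g (\<gamma> t)) has_derivative (\<lambda>h. D (h *\<^sub>R v t))) (at t within {0..1})"
      using der[OF t] D unfolding has_vector_derivative_def by (rule has_derivative_compose)
    then have "((\<lambda>t. g (\<gamma> t)) has_vector_derivative D (v t)) (at t within {0..1})"
      using has_derivative_bounded_linear[OF D] by (simp add: has_vector_derivative_def linear_simps)
    then have g': "((\<lambda>t. g (\<gamma> t) $ i $ j) has_real_derivative D (v t) $ i $ j) (at t within {0..1})" for i j
      unfolding has_real_derivative_iff_has_vector_derivative
      by (intro bounded_linear.has_vector_derivative[OF bounded_linear_vec_nth])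
    have v': "((\<lambda>t. v t $ i) has_real_derivative a $ i) (at t within {0..1})" for i
      using geo[OF t] unfolding has_real_derivative_iff_has_vector_derivative a_def[symmetric]
      by (intro bounded_linear.has_vector_derivative[OF bounded_linear_vec_nth])
    let ?G = "g (\<gamma> t)" and ?v = "v t"
    have expand: "x \<bullet> (A *v y) = (\<Sum>i\<in>UNIV. \<Sum>j\<in>UNIV. A $ i $ j * x $ i * y $ j)"
      for x y :: "real ^ 'm" and A
      by (simp add: inner_vec_def matrix_vector_mult_def sum_distrib_left mult_ac)
    have E': "((\<lambda>t. v t \<bullet> (g (\<gamma> t) *v v t)) has_real_derivative
        (\<Sum>i\<in>UNIV. \<Sum>j\<in>UNIV. D ?v $ i $ j * ?v $ i * ?v $ j + ?G $ i $ j * a $ i * ?v $ j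
           + ?G $ i $ j * ?v $ i * a $ j)) (at t within {0..1})"
      unfolding expand
      by (auto intro!: derivative_eq_intros g' v' sum.cong simp: algebra_simps)
    \<comment> \<open>Symmetry of the metric merges the two acceleration terms into twice one
      pairing.\<close>
    have "(\<Sum>i\<in>UNIV. \<Sum>j\<in>UNIV. ?G $ i $ j * a $ i * ?v $ j) =
        (\<Sum>i\<in>UNIV. \<Sum>j\<in>UNIV. ?G $ i $ j * ?v $ i * a $ j)"
      by (subst sum.swap) (simp add: sym[OF \<gamma>t] mult_ac)
    then have "(\<Sum>i\<in>UNIV. \<Sum>j\<in>UNIV. D ?v $ i $ j * ?v $ i * ?v $ j + ?G $ i $ j * a $ i * ?v $ j
           + ?G $ i $ j * ?v $ i * a $ j) =
        (\<Sum>i\<in>UNIV. \<Sum>j\<in>UNIV. D ?v $ i $ j * ?v $ i * ?v $ j) + 2 * (?v \<bullet> (?G *v a))"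
      by (simp add: sum.distrib expand)
    also have "\<dots> = 0"
      unfolding a_def
      by (subst christoffel_contraction[where g = g and x = "\<gamma> t", OF positive_definite_matrix_inv[OF pos[OF \<gamma>t]]])
        (simp_all add: has_derivative_component_expansion[OF D] sum_distrib_right sum_distrib_left mult_ac)
    finally show ?thesis
      using E' by (simp add: has_real_derivative_iff_has_vector_derivative)
  qed
  then obtain E where "\<And>t. t \<in> {0..1} \<Longrightarrow> v t \<bullet> (g (\<gamma> t) *v v t) = E"
    by (rule has_vector_derivative_zero_constant[of "{0..1::real}", rotated]) auto
  then show thesis
    by (rule that)
qed

section \<open>Riemannian distance along a minimizing geodesic\<close>

lemma curve_length_nonneg:
  assumes "\<And>x v. x \<in> \<Theta> \<Longrightarrow> v \<bullet> (g x *v v) \<ge> 0" and "admissible_curve g \<Theta> c"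
  shows "curve_length g c \<ge> 0"
  unfolding curve_length_def
proof (rule integral_nonneg)
  fix t :: real assume "t \<in> {0..1}"
  then have "c t \<in> \<Theta>"
    using assms(2) by (auto simp: admissible_curve_def path_image_def)
  then show "0 \<le> speed g c t"
    using assms(1) by (simp add: speed_def)
qed (use assms(2) in \<open>simp add: admissible_curve_def\<close>)

text \<open>Nonnegativity of lengths bounds the set below, without which the real \<open>Inf\<close>
  need not be a lower bound.\<close>

lemma riemannian_distance_le:
  assumes "\<And>x v. x \<in> \<Theta> \<Longrightarrow> v \<bullet> (g x *v v) \<ge> 0" and "admissible_curve g \<Theta> c"
    and "pathstart c = x" "pathfinish c = y"
  shows "riemannian_distance g \<Theta> x y \<le> curve_length g c"
  unfolding riemannian_distance_def
proof (rule cInf_lower)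
  show "bdd_below {curve_length g c |c. admissible_curve g \<Theta> c \<and> pathstart c = x \<and> pathfinish c = y}"
    using curve_length_nonneg[of \<Theta> g, OF assms(1)] by (intro bdd_belowI[of _ 0]) blast
qed (use assms in blast)

lemma riemannian_distance_along_minimizer:
  fixes g :: "real ^ 'm::finite \<Rightarrow> real ^ 'm ^ 'm"
  assumes nonneg: "\<And>x v. x \<in> \<Theta> \<Longrightarrow> v \<bullet> (g x *v v) \<ge> 0"
    and img: "\<gamma> ` {0..1} \<subseteq> \<Theta>"
    and der: "\<And>t. t \<in> {0..1} \<Longrightarrow> (\<gamma> has_vector_derivative v t) (at t within {0..1})"
    and cont: "continuous_on {0..1} v"
    and speed: "\<And>t. t \<in> {0..1} \<Longrightarrow> sqrt (v t \<bullet> (g (\<gamma> t) *v v t)) = k"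
    and minimizing: "length_minimizing g \<Theta> \<gamma>"
    and ab: "0 \<le> a" "a \<le> b" "b \<le> 1"
  shows "riemannian_distance g \<Theta> (\<gamma> a) (\<gamma> b) = k * (b - a)"
proof -
  \<comment> \<open>The case \<open>r = s\<close> is allowed and gives a constant curve of length
    \<open>0\<close>, so the splice below also covers \<open>a = 0\<close> and
    \<open>b = 1\<close>.\<close>
  define seg where "seg r s = (\<lambda>x. \<gamma> (r + (s - r) * x))" for r s
  have seg: "admissible_curve g \<Theta> (seg r s) \<and> curve_length g (seg r s) = k * (s - r)"
    if rs: "0 \<le> r" "r \<le> s" "s \<le> 1" for r s
  proof -
    define w where "w x = (s - r) *\<^sub>R v (r + (s - r) * x)" for x
    have mem: "r + (s - r) * x \<in> {0..1}" if "x \<in> {0..1}" for x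
    proof -
      have "(s - r) * x \<le> (s - r) * 1" "0 \<le> (s - r) * x"
        using rs that by (simp_all add: mult_left_le)
      then show ?thesis using rs by auto
    qed
    have "(seg r s has_vector_derivative w x) (at x within {0..1})" if x: "x \<in> {0..1}" for x
    proof -
      have "((\<lambda>x. r + (s - r) * x) has_vector_derivative (s - r)) (at x within {0..1})"
        by (auto intro!: derivative_eq_intros)
      moreover have "(\<gamma> has_vector_derivative v (r + (s - r) * x))
          (at (r + (s - r) * x) within (\<lambda>x. r + (s - r) * x) ` {0..1})"
        using der[OF mem[OF x]] by (rule has_vector_derivative_within_subset) (use mem in blast)
      ultimately show ?thesis
        unfolding seg_def w_def by (rule vector_diff_chain_within[unfolded o_def])
    qed
    moreover have "continuous_on {0..1} w"
      unfolding w_def using mem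
      by (intro continuous_intros continuous_on_compose2[OF cont]) auto
    moreover have "seg r s ` {0..1} \<subseteq> \<Theta>"
      using img mem unfolding seg_def by blast
    moreover have "sqrt (w x \<bullet> (g (seg r s x) *v w x)) = k * (s - r)" if "x \<in> {0..1}" for x
      using speed[OF mem[OF that]] rs
      by (simp add: w_def seg_def matrix_vector_mult_scaleR real_sqrt_mult)
    ultimately show ?thesis
      using admissible_curve_constant_speed[of "seg r s" w \<Theta> g]
        curve_length_constant_speed[of "seg r s" w \<Theta> g] by blast
  qed
  have ends: "pathstart (seg r s) = \<gamma> r" "pathfinish (seg r s) = \<gamma> s" for r s
    by (simp_all add: seg_def pathstart_def pathfinish_def)
  have "seg 0 1 = \<gamma>"
    by (simp add: seg_def)
  then have total: "riemannian_distance g \<Theta> (\<gamma> 0) (\<gamma> 1) = k"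
    using seg[of 0 1] minimizing by (simp add: length_minimizing_def)
  have lower: "k * (b - a) \<le> curve_length g c"
    if c: "admissible_curve g \<Theta> c" "pathstart c = \<gamma> a" "pathfinish c = \<gamma> b" for c
  proof -
    \<comment> \<open>Follow \<open>\<gamma>\<close> to \<open>\<gamma> a\<close>, take the detour
      \<open>c\<close>, then follow \<open>\<gamma>\<close> to its end. This competes with the
      minimizer, whose length is \<open>k\<close>.\<close>
    let ?d = "seg 0 a +++ (c +++ seg b 1)"
    have 1: "admissible_curve g \<Theta> (c +++ seg b 1)"
        "curve_length g (c +++ seg b 1) = curve_length g c + k * (1 - b)"
      using c seg[of b 1] ab ends
      by (simp_all add: admissible_curve_join curve_length_join[of g \<Theta>])
    have 2: "admissible_curve g \<Theta> ?d" "curve_length g ?d = k * a + (curve_length g c + k * (1 - b))"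
      using 1 c seg[of 0 a] ab ends
      by (simp_all add: admissible_curve_join curve_length_join[of g \<Theta>])
    have "k \<le> curve_length g ?d"
      using riemannian_distance_le[of \<Theta> g ?d "\<gamma> 0" "\<gamma> 1", OF nonneg 2(1)] ends total by simp
    then show ?thesis
      using 2(2) by (simp add: algebra_simps)
  qed
  have "k * (b - a) \<le> riemannian_distance g \<Theta> (\<gamma> a) (\<gamma> b)"
    unfolding riemannian_distance_def
  proof (rule cInf_greatest)
    show "{curve_length g c |c. admissible_curve g \<Theta> c \<and> pathstart c = \<gamma> a \<and> pathfinish c = \<gamma> b} \<noteq> {}"
      using seg[OF ab] ends by blast
  qed (use lower in blast)
  moreover have "riemannian_distance g \<Theta> (\<gamma> a) (\<gamma> b) \<le> k * (b - a)"
    using riemannian_distance_le[of \<Theta> g, OF nonneg _ ends] seg[OF ab] by metis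
  ultimately show ?thesis
    by simp
qed

text \<open>The constant curve is admissible and has length zero. This direction is what contradicts
  a positive distance from a point to itself.\<close>

lemma riemannian_distance_refl:
  fixes g :: "real ^ 'm::finite \<Rightarrow> real ^ 'm ^ 'm"
  assumes "\<And>x v. x \<in> \<Theta> \<Longrightarrow> v \<bullet> (g x *v v) \<ge> 0" and "x \<in> \<Theta>"
  shows "riemannian_distance g \<Theta> x x \<le> 0"
proof -
  have "admissible_curve g \<Theta> (\<lambda>_. x)" "curve_length g (\<lambda>_. x) = 0"
    using assms(2)
      admissible_curve_constant_speed[of "\<lambda>_. x" "\<lambda>_. 0" \<Theta> g 0]
      curve_length_constant_speed[of "\<lambda>_. x" "\<lambda>_. 0" \<Theta> g 0]
    by auto
  then show ?thesis
    using riemannian_distance_le[of \<Theta> g "\<lambda>_. x" x x, OF assms(1)] by (simp add: pathstart_def pathfinish_def)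
qed

lemma increasing_diffeo_continuous_on:
  assumes "increasing_diffeo u"
  shows "continuous_on {0..1} u"
proof -
  obtain D where D: "D 0 = u"
      "\<And>n t. t \<in> {0..1} \<Longrightarrow> (D n has_real_derivative D (Suc n) t) (at t within {0..1})"
    using assms unfolding increasing_diffeo_def smooth_on_unit_interval_def by blast
  show ?thesis
    unfolding continuous_on_eq_continuous_within
    using D(2)[of _ 0] D(1) by (metis DERIV_continuous)
qed

section \<open>Application to pregeodesics of the Fisher information metric\<close>

theorem mainTheorem9:
  fixes M :: "'x measure"
    and \<Theta> :: "(real ^ 'm::finite) set"
    and p :: "real ^ 'm \<Rightarrow> 'x \<Rightarrow> real"
    and \<theta>0 \<theta>1 :: "real ^ 'm"
    and \<gamma> \<gamma>bar :: "real \<Rightarrow> real ^ 'm"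
    and \<rho>L \<rho>U :: "real ^ 'm \<Rightarrow> real ^ 'm \<Rightarrow> real"
    and \<epsilon> :: real
  assumes model: "regular_statistical_model M \<Theta> p"
    and points: "\<theta>0 \<in> \<Theta>" "\<theta>1 \<in> \<Theta>" "\<theta>0 \<noteq> \<theta>1"
    and pregeodesic: "pregeodesic_tracing (fisher_information M p) \<Theta> \<gamma> \<gamma>bar"
    and minimizing: "length_minimizing (fisher_information M p) \<Theta> \<gamma>"
    and ends: "\<gamma>bar 0 = \<theta>0" "\<gamma>bar 1 = \<theta>1"
    and nonneg: "\<And>\<theta> \<theta>'. \<theta> \<in> \<Theta> \<Longrightarrow> \<theta>' \<in> \<Theta> \<Longrightarrow> 0 \<le> \<rho>L \<theta> \<theta>' \<and> 0 \<le> \<rho>U \<theta> \<theta>'"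
    and bounds: "\<And>\<theta> \<theta>'. \<theta> \<in> \<Theta> \<Longrightarrow> \<theta>' \<in> \<Theta> \<Longrightarrow>
        \<rho>L \<theta> \<theta>' \<le> fisher_rao_distance M \<Theta> p \<theta> \<theta>' \<and> fisher_rao_distance M \<Theta> p \<theta> \<theta>' \<le> \<rho>U \<theta> \<theta>'"
    and tight: "infinitesimally_tight \<Theta> \<rho>L \<rho>U"
    and eps: "\<epsilon> > 0"
  shows "approx_fisher_rao_dom (\<rho>L, \<rho>U, \<epsilon>, \<gamma>bar) \<and>
         fisher_rao_distance M \<Theta> p \<theta>0 \<theta>1 \<le> approx_fisher_rao \<rho>L \<rho>U \<epsilon> \<gamma>bar \<and>
         approx_fisher_rao \<rho>L \<rho>U \<epsilon> \<gamma>bar \<le> (1 + \<epsilon>) * fisher_rao_distance M \<Theta> p \<theta>0 \<theta>1"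
proof -
  let ?g = "fisher_information M p"
  have pos: "v \<bullet> (?g x *v v) > 0" if "x \<in> \<Theta>" "v \<noteq> 0" for x v
    using model that by (simp add: regular_statistical_model_def)
  then have pos': "v \<bullet> (?g x *v v) \<ge> 0" if "x \<in> \<Theta>" for x v
    using that by (cases "v = 0") (auto intro: less_imp_le)
  \<comment> \<open>Level one of \<open>Ck_on\<close> exposes Frechet differentiability of the
    metric.\<close>
  have "Ck_on (Suc 0) ?g \<Theta>"
    using model by (simp only: regular_statistical_model_def smooth_on_def)
  then have diff: "?g differentiable (at x)" if "x \<in> \<Theta>" for x
    using that by simp
  have sym: "?g x $ i $ j = ?g x $ j $ i" for x i j
    by (simp add: fisher_information_def mult.commute[of "score p i x _"])
  let ?a = "\<lambda>v t. \<chi> k. - (\<Sum>i\<in>UNIV. \<Sum>j\<in>UNIV. christoffel ?g (\<gamma> t) k i j * v t $ i * v t $ j)"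
  have img: "\<gamma> ` {0..1} \<subseteq> \<Theta>"
    using pregeodesic by (simp add: pregeodesic_tracing_def constant_speed_geodesic_def)
  then have \<gamma>_mem: "\<gamma> t \<in> \<Theta>" if "t \<in> {0..1}" for t
    using that by blast
  obtain v where v: "\<forall>t\<in>{0..1}. (\<gamma> has_vector_derivative v t) (at t within {0..1}) \<and>
      (v has_vector_derivative ?a v t) (at t within {0..1})"
    using pregeodesic unfolding pregeodesic_tracing_def constant_speed_geodesic_def by blast
  then have der: "\<And>t. t \<in> {0..1} \<Longrightarrow> (\<gamma> has_vector_derivative v t) (at t within {0..1})"
    and geo: "\<And>t. t \<in> {0..1} \<Longrightarrow> (v has_vector_derivative ?a v t) (at t within {0..1})"
    by blast+
  obtain u where u: "increasing_diffeo u" and \<gamma>bar: "\<And>t. t \<in> {0..1} \<Longrightarrow> \<gamma>bar t = \<gamma> (u t)"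
    using pregeodesic unfolding pregeodesic_tracing_def by blast
  obtain E where E: "\<And>t. t \<in> {0..1} \<Longrightarrow> v t \<bullet> (?g (\<gamma> t) *v v t) = E"
    by (rule geodesic_speed_constant[of \<Theta> ?g \<gamma> v, OF diff sym pos img der geo]) blast+
  define k where "k = sqrt E"
  have v_cont: "continuous_on {0..1} v"
    using geo unfolding continuous_on_eq_continuous_within
    by (blast intro: has_vector_derivative_continuous)
  have dist_\<gamma>: "fisher_rao_distance M \<Theta> p (\<gamma> a) (\<gamma> b) = k * (b - a)"
    if "0 \<le> a" "a \<le> b" "b \<le> 1" for a b
    by (rule riemannian_distance_along_minimizer[of \<Theta> ?g, OF pos' img der v_cont _ minimizing that])
      (simp_all add: E k_def)
  have u_mem: "u t \<in> {0..1}" if "t \<in> {0..1}" for t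
    using u that unfolding increasing_diffeo_def by (blast dest: bij_betwE)
  have u_mono: "u s < u t" if "s \<in> {0..1}" "t \<in> {0..1}" "s < t" for s t
    using u that unfolding increasing_diffeo_def strict_mono_on_def by blast
  have "E \<ge> 0"
    using E[of 0] pos'[OF \<gamma>_mem, of 0 "v 0"] by simp
  \<comment> \<open>Zero energy forces zero velocity by positive definiteness, so
    \<open>\<gamma>\<close> would be constant, against
    \<open>\<theta>0 \<noteq> \<theta>1\<close>.\<close>
  moreover have "E \<noteq> 0"
  proof
    assume "E = 0"
    then have "v t = 0" if "t \<in> {0..1}" for t
      using E[OF that] pos[OF \<gamma>_mem[OF that], of "v t"] by fastforce
    then have "(\<gamma> has_vector_derivative 0) (at t within {0..1})" if "t \<in> {0..1}" for t
      using der[OF that] that by simp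
    then obtain z where "\<And>t. t \<in> {0..1} \<Longrightarrow> \<gamma> t = z"
      by (rule has_vector_derivative_zero_constant[of "{0..1::real}", rotated]) auto
    then have "\<gamma>bar 0 = \<gamma>bar 1"
      using \<gamma>bar[of 0] \<gamma>bar[of 1] u_mem[of 0] u_mem[of 1] by simp
    then show False
      using ends points by simp
  qed
  ultimately have "k > 0"
    by (simp add: k_def)
  \<comment> \<open>A repeated point would have distance \<open>k * (u t - u s) > 0\<close> to
    itself.\<close>
  have separated: "\<gamma>bar s \<noteq> \<gamma>bar t" if st: "s \<in> {0..1}" "t \<in> {0..1}" "s < t" for s t
  proof
    assume "\<gamma>bar s = \<gamma>bar t"
    then have "k * (u t - u s) \<le> 0"
      using dist_\<gamma>[of "u s" "u t"] riemannian_distance_refl[of \<Theta> ?g "\<gamma> (u s)", OF pos']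
        u_mono[OF st] u_mem[OF st(1)] u_mem[OF st(2)] \<gamma>bar[OF st(1)] \<gamma>bar[OF st(2)]
        \<gamma>_mem[OF u_mem[OF st(1)]]
      by auto
    then show False
      using \<open>k > 0\<close> u_mono[OF st] by (simp add: mult_le_0_iff)
  qed
  have inj: "inj_on \<gamma>bar {0..1}"
    by (rule linorder_inj_onI) (use separated in auto)
  have bar_img: "\<gamma>bar ` {0..1} \<subseteq> \<Theta>"
    using \<gamma>bar \<gamma>_mem u_mem by auto
  have "continuous_on {0..1} \<gamma>"
    using der unfolding continuous_on_eq_continuous_within
    by (blast intro: has_vector_derivative_continuous)
  then have "continuous_on {0..1} (\<lambda>t. \<gamma> (u t))"
    using increasing_diffeo_continuous_on[OF u]
    by (rule continuous_on_compose2) (use u_mem in blast)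
  then have cont: "continuous_on {0..1} \<gamma>bar"
    by (rule continuous_on_eq) (simp add: \<gamma>bar)
  \<comment> \<open>Distances along the pregeodesic are increments of \<open>k * u\<close>, hence
    telescope; reparameterization by \<open>u\<close> does not disturb additivity. The case
    \<open>s = t\<close> is separate because \<open>u_mono\<close> is strict.\<close>
  have dist_bar: "fisher_rao_distance M \<Theta> p (\<gamma>bar s) (\<gamma>bar t) = k * (u t - u s)"
    if "0 \<le> s" "s \<le> t" "t \<le> 1" for s t
    using dist_\<gamma>[of "u s" "u t"] u_mono[of s t] u_mem[of s] u_mem[of t] \<gamma>bar[of s] \<gamma>bar[of t] that
    by (cases "s = t") auto
  have additive: "fisher_rao_distance M \<Theta> p (\<gamma>bar r) (\<gamma>bar t) =
      fisher_rao_distance M \<Theta> p (\<gamma>bar r) (\<gamma>bar s) + fisher_rao_distance M \<Theta> p (\<gamma>bar s) (\<gamma>bar t)"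
    if "0 \<le> r" "r \<le> s" "s \<le> t" "t \<le> 1" for r s t
    using that by (simp add: dist_bar algebra_simps)
  show ?thesis
    using approx_fisher_rao_along_curve[OF cont inj bar_img additive bounds tight eps]
    unfolding ends .
qed

end
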